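(* Let $t>0$, let $i_1<\dots<i_M$ be real, let $\underline b=(b_2,\dots,b_{M-1})$ satisfy $-\frac{1}{i_{j+1}-i_j}<b_j<\frac{1}{i_j-i_{j-1}}$ for $j=2,\dots,M-1$, and let $\underline k\in\mathbb R_+^{M-2}$. Let $j\in\{2,\dots,M-1\}$. If $\lambda_j\to+\infty$ (along any sequence of vectors $\underline\lambda\in\mathbb R_+^{M-2}$), then the $j$th column of $\mathcal N_t(\underline k,\underline\lambda)^{-1}$ converges to the zero vector, and consequently, for any integer $p\ge1$, the $j$th column of $\mathcal N_t(\underline k,\underline\lambda)^{-p}$ converges to the zero vector.
   Context: Conventions: $\mathbb R_+=[0,\infty)$, $M\ge3$, $\underline\lambda=(\lambda_2,\dots,\lambda_{M-1})$. Set $\widetilde k_j=(i_{j+1}-i_j)(i_j-i_{j-1})k_j$ for $2\le j\le M-1$; for $2\le j\le M-1$, $q_{j,j+1}=\frac{i_j-i_{j-1}}{i_{j+1}-i_{j-1}}(1+(i_{j+1}-i_j)b_j)$, $q_{j,j-1}=\frac{i_{j+1}-i_j}{i_{j+1}-i_{j-1}}(1-(i_j-i_{j-1})b_j)$. $\mathcal N_t=\mathcal N_t(\underline k,\underline\lambda)$ is the $M\times M$ matrix whose first and last rows are those of the identity matrix and, for $2\le j\le M-1$, $\mathcal N_{t;j,j}=1+t\lambda_j(1+\widetilde k_j)$, $\mathcal N_{t;j,j+1}=-t\lambda_jq_{j,j+1}$, $\mathcal N_{t;j,j-1}=-t\lambda_jq_{j,j-1}$, all other entries $0$. *)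

theory Defs
  imports Complex_Main "Jordan_Normal_Form.Gauss_Jordan_Elimination"
begin

(* Vectors such as (i_1,...,i_M) or (b_2,...,b_(M-1)) are functions on nat carrying the
   original one-based indices; values outside the index range are never used. *)

definition ktilde :: "(nat \<Rightarrow> real) \<Rightarrow> (nat \<Rightarrow> real) \<Rightarrow> nat \<Rightarrow> real" where
  "ktilde i k j = (i (j + 1) - i j) * (i j - i (j - 1)) * k j"

definition q_up :: "(nat \<Rightarrow> real) \<Rightarrow> (nat \<Rightarrow> real) \<Rightarrow> nat \<Rightarrow> real" where
  "q_up i b j = (i j - i (j - 1)) / (i (j + 1) - i (j - 1)) * (1 + (i (j + 1) - i j) * b j)"

definition q_down :: "(nat \<Rightarrow> real) \<Rightarrow> (nat \<Rightarrow> real) \<Rightarrow> nat \<Rightarrow> real" where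
  "q_down i b j = (i (j + 1) - i j) / (i (j + 1) - i (j - 1)) * (1 - (i j - i (j - 1)) * b j)"

definition N_entry ::
  "nat \<Rightarrow> (nat \<Rightarrow> real) \<Rightarrow> (nat \<Rightarrow> real) \<Rightarrow> real \<Rightarrow> (nat \<Rightarrow> real) \<Rightarrow> (nat \<Rightarrow> real) \<Rightarrow> nat \<Rightarrow> nat \<Rightarrow> real"
where
  "N_entry M i b t k lam r c =
     (if r = 1 \<or> r = M then (if c = r then 1 else 0)
      else if c = r then 1 + t * lam r * (1 + ktilde i k r)
      else if c = r + 1 then - t * lam r * q_up i b r
      else if c = r - 1 then - t * lam r * q_down i b r
      else 0)"

(* Matrices of type real mat are indexed from 0, hence the shift by one. *)
definition N_mat ::
  "nat \<Rightarrow> (nat \<Rightarrow> real) \<Rightarrow> (nat \<Rightarrow> real) \<Rightarrow> real \<Rightarrow> (nat \<Rightarrow> real) \<Rightarrow> (nat \<Rightarrow> real) \<Rightarrow> real mat"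
where
  "N_mat M i b t k lam = mat M M (\<lambda>(r, c). N_entry M i b t k lam (r + 1) (c + 1))"

(* The inverse; meaningful only if A is an invertible square matrix
   (otherwise mat_inverse A is None). *)
definition inv_mat :: "real mat \<Rightarrow> real mat" where
  "inv_mat A = the (mat_inverse A)"

(* The type of vectors of arbitrary dimension carries no topology; this is convergence in
   the space of real vectors of dimension dim_vec v, which is entrywise. *)
definition vec_LIMSEQ :: "(nat \<Rightarrow> real vec) \<Rightarrow> real vec \<Rightarrow> bool" where
  "vec_LIMSEQ X v \<longleftrightarrow>
     (\<forall>n. dim_vec (X n) = dim_vec v) \<and> (\<forall>r < dim_vec v. (\<lambda>n. X n $ r) \<longlonglongrightarrow> v $ r)"

end

theory Submission
  imports Defs "Jordan_Normal_Form.Determinant"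
begin

text \<open>
  The off-diagonal weights are positive and sum to \<open>1\<close>, so \<open>\<N>\<close> obeys a discrete minimum
  principle: it is invertible with a nonnegative inverse.  Let \<open>w \<ge> 0\<close> satisfy
  \<open>q\<^sub>l\<^sub>,\<^sub>l\<^sub>+\<^sub>1 w\<^sub>l\<^sub>+\<^sub>1 + q\<^sub>l\<^sub>,\<^sub>l\<^sub>-\<^sub>1 w\<^sub>l\<^sub>-\<^sub>1 < w\<^sub>l\<close> at every interior \<open>l\<close>, independently of \<open>\<lambda>\<close>; one may
  take \<open>w\<^sub>l = a\<^sup>M - a\<^sup>l\<close> with \<open>a\<close> large.  If \<open>\<delta>\<close> is the defect of this inequality at \<open>j\<close>, then
  \<open>\<N> w \<ge> t \<lambda>\<^sub>j \<delta> e\<^sub>j\<close> and \<open>\<N> w \<ge> w\<close>, so comparison gives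
  \<open>0 \<le> t \<lambda>\<^sub>j \<delta> \<N>\<^sup>-\<^sup>p e\<^sub>j \<le> w\<close> for all \<open>p \<ge> 1\<close>, and the columns tend to \<open>0\<close> as \<open>\<lambda>\<^sub>j \<rightarrow> \<infinity>\<close>.
\<close>

lemma q_up_add_q_down:
  assumes "i (l - 1) < i l" "i l < i (l + 1)"
  shows "q_up i b l + q_down i b l = 1"
  using assms by (simp add: q_up_def q_down_def divide_simps) (simp add: algebra_simps)

lemma q_up_pos:
  assumes "i (l - 1) < i l" "i l < i (l + 1)" "- (1 / (i (l + 1) - i l)) < b l"
  shows "0 < q_up i b l"
proof -
  have "0 < 1 + (i (l + 1) - i l) * b l"
    using assms by (simp add: field_simps)
  then show ?thesis
    using assms by (simp add: q_up_def)
qed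

lemma q_down_pos:
  assumes "i (l - 1) < i l" "i l < i (l + 1)" "b l < 1 / (i l - i (l - 1))"
  shows "0 < q_down i b l"
proof -
  have "0 < 1 - (i l - i (l - 1)) * b l"
    using assms by (simp add: field_simps)
  then show ?thesis
    using assms by (simp add: q_down_def)
qed

locale tridiagonal =
  fixes M :: nat and t :: real and i b k :: "nat \<Rightarrow> real"
  assumes t_pos: "0 < t"
    and i_mono: "strict_mono_on {1..M} i"
    and b_bounds: "l \<in> {2..M - 1} \<Longrightarrow>
      - (1 / (i (l + 1) - i l)) < b l \<and> b l < 1 / (i l - i (l - 1))"
    and k_nonneg: "l \<in> {2..M - 1} \<Longrightarrow> 0 \<le> k l"
begin

lemma i_step:
  assumes "l \<in> {2..M - 1}"
  shows "i (l - 1) < i l" "i l < i (l + 1)"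
  using assms by (auto intro!: strict_mono_onD[OF i_mono])

lemma weights:
  assumes "l \<in> {2..M - 1}"
  shows "q_up i b l + q_down i b l = 1" "0 < q_up i b l" "0 < q_down i b l" "0 \<le> ktilde i k l"
  using q_up_add_q_down q_up_pos q_down_pos i_step[OF assms] b_bounds[OF assms] k_nonneg[OF assms]
  by (auto simp: ktilde_def)

text \<open>Rows \<open>r\<close> of the matrix type are numbered from \<open>0\<close> while \<open>q_up\<close>, \<open>q_down\<close> are numbered
  from \<open>1\<close>, so the weights of row \<open>r\<close> carry the index \<open>r + 1\<close>.\<close>

definition nbr_avg :: "(nat \<Rightarrow> real) \<Rightarrow> nat \<Rightarrow> real" where
  "nbr_avg w r = q_up i b (r + 1) * w (r + 1) + q_down i b (r + 1) * w (r - 1)"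

lemma nbr_avg_ge:
  assumes "r \<in> {1..<M - 1}" "m \<le> w (r + 1)" "m \<le> w (r - 1)"
  shows "m \<le> nbr_avg w r"
proof -
  have r: "r + 1 \<in> {2..M - 1}"
    using assms(1) by auto
  have "m = q_up i b (r + 1) * m + q_down i b (r + 1) * m"
    using weights(1)[OF r] by (metis distrib_right mult_1)
  also have "\<dots> \<le> nbr_avg w r"
    unfolding nbr_avg_def using assms weights[OF r] by (intro add_mono mult_left_mono) auto
  finally show ?thesis .
qed

definition barrier :: "(nat \<Rightarrow> real) \<Rightarrow> bool" where
  "barrier w \<longleftrightarrow> (\<forall>r<M. 0 \<le> w r) \<and> (\<forall>r\<in>{1..<M - 1}. nbr_avg w r < w r)"

lemma barrier_exists: "\<exists>w. barrier w"
proof -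
  define a where "a = 1 + (\<Sum>l\<in>{2..M - 1}. 1 / q_up i b l)"
  have a1: "1 \<le> a"
    unfolding a_def using weights(2) sum_nonneg[of "{2..M - 1}" "\<lambda>l. 1 / q_up i b l"]
    by (simp add: less_imp_le)
  have a_gt: "1 < q_up i b l * a" if l: "l \<in> {2..M - 1}" for l
  proof -
    have "1 / q_up i b l \<le> (\<Sum>l\<in>{2..M - 1}. 1 / q_up i b l)"
      using l weights(2) by (intro member_le_sum) (auto intro: less_imp_le)
    then have "1 / q_up i b l < a"
      by (simp add: a_def)
    then show ?thesis
      using weights(2)[OF l] by (simp add: field_simps)
  qed
  have "nbr_avg (\<lambda>r. a ^ M - a ^ r) r < a ^ M - a ^ r" if r: "r \<in> {1..<M - 1}" for r
  proof -
    have l: "r + 1 \<in> {2..M - 1}"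
      using r by auto
    have "nbr_avg (\<lambda>r. a ^ M - a ^ r) r =
        (q_up i b (r + 1) + q_down i b (r + 1)) * a ^ M
        - q_up i b (r + 1) * a * a ^ r - q_down i b (r + 1) * a ^ (r - 1)"
      by (simp add: nbr_avg_def algebra_simps)
    moreover have "1 * a ^ r < q_up i b (r + 1) * a * a ^ r"
      using a1 a_gt[OF l] by (intro mult_strict_right_mono) auto
    moreover have "0 \<le> q_down i b (r + 1) * a ^ (r - 1)"
      using a1 weights(3)[OF l] by auto
    ultimately show ?thesis
      using weights(1)[OF l] by simp
  qed
  moreover have "0 \<le> a ^ M - a ^ r" if "r < M" for r
    using that a1 by (simp add: power_increasing)
  ultimately have "barrier (\<lambda>r. a ^ M - a ^ r)"
    unfolding barrier_def by simp
  then show ?thesis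
    by (rule exI[where P = barrier])
qed

end

locale tridiagonal_rates = tridiagonal +
  fixes lam :: "nat \<Rightarrow> real"
  assumes lam_nonneg: "l \<in> {2..M - 1} \<Longrightarrow> 0 \<le> lam l"
begin

abbreviation N where "N \<equiv> N_mat M i b t k lam"

lemma N_carrier: "N \<in> carrier_mat M M"
  by (simp add: N_mat_def)

lemma N_mult:
  assumes "v \<in> carrier_vec M" "r < M"
  shows "(N *\<^sub>v v) $ r = (\<Sum>c<M. N_entry M i b t k lam (r + 1) (c + 1) * v $ c)"
  using assms by (simp add: N_mat_def scalar_prod_def atLeast0LessThan)

lemma N_mult_boundary:
  assumes "v \<in> carrier_vec M" "r < M" "r = 0 \<or> r = M - 1"
  shows "(N *\<^sub>v v) $ r = v $ r"
proof -
  have "(N *\<^sub>v v) $ r = (\<Sum>c<M. N_entry M i b t k lam (r + 1) (c + 1) * v $ c)"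
    using N_mult assms by blast
  also have "\<dots> = (\<Sum>c<M. if c = r then v $ c else 0)"
    using assms by (intro sum.cong) (auto simp: N_entry_def)
  finally show ?thesis
    using assms by simp
qed

lemma N_mult_interior:
  assumes v: "v \<in> carrier_vec M" and r: "r \<in> {1..<M - 1}"
  shows "(N *\<^sub>v v) $ r =
    v $ r + t * lam (r + 1) * (ktilde i k (r + 1) * v $ r + (v $ r - nbr_avg (($) v) r))"
proof -
  have "(N *\<^sub>v v) $ r = (\<Sum>c<M. N_entry M i b t k lam (r + 1) (c + 1) * v $ c)"
    using N_mult[OF v] r by auto
  also have "\<dots> = (\<Sum>c\<in>{r - 1, r, r + 1}. N_entry M i b t k lam (r + 1) (c + 1) * v $ c)"
    using r by (intro sum.mono_neutral_right) (auto simp: N_entry_def)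
  also have "\<dots> = v $ r + t * lam (r + 1) *
      (ktilde i k (r + 1) * v $ r + (v $ r - nbr_avg (($) v) r))"
  proof -
    obtain u where "r = Suc u" "r + 1 \<noteq> M"
      using r by (cases r) auto
    then show ?thesis
      using r by (simp add: N_entry_def nbr_avg_def algebra_simps)
  qed
  finally show ?thesis .
qed

lemma minimum_principle:
  assumes v: "v \<in> carrier_vec M" and Nv: "\<And>r. r < M \<Longrightarrow> 0 \<le> (N *\<^sub>v v) $ r" and "r < M"
  shows "0 \<le> v $ r"
proof -
  have "finite {..<M}" "{..<M} \<noteq> {}"
    using \<open>r < M\<close> by auto
  then obtain s where s: "s < M" and min: "\<And>r. r < M \<Longrightarrow> v $ s \<le> v $ r"
    using arg_min_if_finite[of "{..<M}" "($) v"] by (metis lessThan_iff not_le)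
  have "0 \<le> v $ s"
  proof (cases "s = 0 \<or> s = M - 1")
    case True
    then show ?thesis
      using N_mult_boundary[OF v s] Nv[OF s] by simp
  next
    case False
    then have s': "s \<in> {1..<M - 1}" and l: "s + 1 \<in> {2..M - 1}"
      using s by auto
    show ?thesis
    proof (rule ccontr)
      assume neg: "\<not> 0 \<le> v $ s"
      have "v $ s \<le> nbr_avg (($) v) s"
        using s' by (intro nbr_avg_ge min) auto
      moreover have "ktilde i k (s + 1) * v $ s \<le> 0"
        using neg weights(4)[OF l] by (simp add: mult_nonneg_nonpos)
      ultimately have "t * lam (s + 1) *
          (ktilde i k (s + 1) * v $ s + (v $ s - nbr_avg (($) v) s)) \<le> 0"
        using t_pos lam_nonneg[OF l] by (intro mult_nonneg_nonpos) auto
      then show False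
        using N_mult_interior[OF v s'] Nv[OF s] neg by simp
    qed
  qed
  then show ?thesis
    using min[OF \<open>r < M\<close>] by simp
qed

lemma det_N: "det N \<noteq> 0"
proof
  assume "det N = 0"
  then obtain v where v: "v \<in> carrier_vec M" "v \<noteq> 0\<^sub>v M" "N *\<^sub>v v = 0\<^sub>v M"
    using det_0_iff_vec_prod_zero_field[OF N_carrier] by auto
  have "N *\<^sub>v (- 1 \<cdot>\<^sub>v v) = - 1 \<cdot>\<^sub>v 0\<^sub>v M"
    using mult_mat_vec[OF N_carrier v(1), of "- 1"] v(3) by simp
  then have "0 \<le> v $ r" "0 \<le> (- 1 \<cdot>\<^sub>v v) $ r" if "r < M" for r
    using that v minimum_principle[of v r] minimum_principle[of "- 1 \<cdot>\<^sub>v v" r] by auto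
  then have "v = 0\<^sub>v M"
    using v(1) by (intro eq_vecI) (auto intro: antisym)
  with v(2) show False ..
qed

lemma inv_N:
  shows "N * inv_mat N = 1\<^sub>m M" "inv_mat N * N = 1\<^sub>m M" "inv_mat N \<in> carrier_mat M M"
proof -
  have "N \<in> Units (ring_mat TYPE(real) M ())"
    using det_non_zero_imp_unit[OF N_carrier det_N] .
  then have "mat_inverse N \<noteq> None"
    using mat_inverse(1)[OF N_carrier, where b = "()"] by blast
  then show "N * inv_mat N = 1\<^sub>m M" "inv_mat N * N = 1\<^sub>m M" "inv_mat N \<in> carrier_mat M M"
    using mat_inverse(2)[OF N_carrier] by (auto simp: inv_mat_def)
qed

lemma invertible_N: "invertible_mat N"
  using inv_N N_carrier by (auto simp: invertible_mat_def inverts_mat_def)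

lemma N_mult_barrier:
  assumes w: "barrier w" and r: "r < M"
  shows "w r \<le> (N *\<^sub>v vec M w) $ r"
    and "r \<in> {1..<M - 1} \<Longrightarrow> t * lam (r + 1) * (w r - nbr_avg w r) \<le> (N *\<^sub>v vec M w) $ r"
proof -
  have int: "w r \<le> (N *\<^sub>v vec M w) $ r \<and>
      t * lam (r + 1) * (w r - nbr_avg w r) \<le> (N *\<^sub>v vec M w) $ r" if r': "r \<in> {1..<M - 1}"
  proof -
    have l: "r + 1 \<in> {2..M - 1}"
      using r' by auto
    have "nbr_avg (($) (vec M w)) r = nbr_avg w r"
      using r' by (auto simp: nbr_avg_def)
    then have "(N *\<^sub>v vec M w) $ r =
        w r + t * lam (r + 1) * (ktilde i k (r + 1) * w r + (w r - nbr_avg w r))"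
      using N_mult_interior[OF _ r', of "vec M w"] r by simp
    moreover have "0 \<le> t * lam (r + 1) * (ktilde i k (r + 1) * w r)"
      using t_pos lam_nonneg[OF l] weights(4)[OF l] w r by (auto simp: barrier_def)
    moreover have "0 \<le> t * lam (r + 1) * (w r - nbr_avg w r)"
      using t_pos lam_nonneg[OF l] w r'
      by (intro mult_nonneg_nonneg) (simp_all add: barrier_def less_imp_le)
    moreover have "0 \<le> w r"
      using w r by (simp add: barrier_def)
    ultimately show ?thesis
      by (simp add: distrib_left)
  qed
  then show "r \<in> {1..<M - 1} \<Longrightarrow> t * lam (r + 1) * (w r - nbr_avg w r) \<le> (N *\<^sub>v vec M w) $ r"
    by simp
  show "w r \<le> (N *\<^sub>v vec M w) $ r"
    using int N_mult_boundary[of "vec M w" r] r by (cases "r = 0 \<or> r = M - 1") auto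
qed

lemma comparison:
  assumes x: "x \<in> carrier_vec M" and z: "z \<in> carrier_vec M"
    and Nx: "\<And>r. r < M \<Longrightarrow> 0 \<le> (N *\<^sub>v x) $ r"
    and Nz: "\<And>r. r < M \<Longrightarrow> D * (N *\<^sub>v x) $ r \<le> (N *\<^sub>v z) $ r" and r: "r < M"
  shows "0 \<le> x $ r \<and> D * x $ r \<le> z $ r"
proof
  show "0 \<le> x $ r"
    using minimum_principle[OF x Nx r] .
  have "N *\<^sub>v (z - D \<cdot>\<^sub>v x) = N *\<^sub>v z - D \<cdot>\<^sub>v (N *\<^sub>v x)"
    using mult_minus_distrib_mat_vec[OF N_carrier z, of "D \<cdot>\<^sub>v x"] mult_mat_vec[OF N_carrier x] x
    by simp
  moreover have "N *\<^sub>v x \<in> carrier_vec M"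
    using N_carrier x by (rule mult_mat_vec_carrier)
  ultimately have "0 \<le> (N *\<^sub>v (z - D \<cdot>\<^sub>v x)) $ s" if "s < M" for s
    using that Nz[OF that] N_carrier by simp
  moreover have "z - D \<cdot>\<^sub>v x \<in> carrier_vec M"
    using x z by simp
  ultimately have "0 \<le> (z - D \<cdot>\<^sub>v x) $ r"
    using minimum_principle r by blast
  then show "D * x $ r \<le> z $ r"
    using x z r by simp
qed

lemma N_mult_inv:
  assumes "v \<in> carrier_vec M"
  shows "N *\<^sub>v (inv_mat N *\<^sub>v v) = v"
  using assoc_mult_mat_vec[OF N_carrier inv_N(3) assms] inv_N(1) assms by simp

lemma inv_power_mult_bound:
  assumes w: "barrier w" and y: "y \<in> carrier_vec M"
    and bound: "\<And>r. r < M \<Longrightarrow> 0 \<le> y $ r \<and> D * y $ r \<le> w r" and "r < M"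
  shows "0 \<le> (inv_mat N ^\<^sub>m p *\<^sub>v y) $ r \<and> D * (inv_mat N ^\<^sub>m p *\<^sub>v y) $ r \<le> w r"
  using y bound \<open>r < M\<close>
proof (induction p arbitrary: y r)
  case 0
  then show ?case
    using inv_N(3) by simp
next
  case (Suc p)
  let ?x = "inv_mat N *\<^sub>v y"
  have x: "?x \<in> carrier_vec M"
    using inv_N(3) Suc.prems(1) by simp
  have Nx: "N *\<^sub>v ?x = y"
    using N_mult_inv Suc.prems(1) .
  have "0 \<le> ?x $ s \<and> D * ?x $ s \<le> vec M w $ s" if "s < M" for s
  proof (rule comparison[OF x _ _ _ that])
    show "0 \<le> (N *\<^sub>v ?x) $ r" "D * (N *\<^sub>v ?x) $ r \<le> (N *\<^sub>v vec M w) $ r" if "r < M" for r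
      using Suc.prems(2)[OF that] N_mult_barrier(1)[OF w that] Nx by auto
  qed simp
  then have "0 \<le> (inv_mat N ^\<^sub>m p *\<^sub>v ?x) $ r \<and> D * (inv_mat N ^\<^sub>m p *\<^sub>v ?x) $ r \<le> w r"
    using Suc.IH[OF x] Suc.prems(3) by simp
  moreover have "inv_mat N ^\<^sub>m Suc p *\<^sub>v y = inv_mat N ^\<^sub>m p *\<^sub>v ?x"
    using inv_N(3) Suc.prems(1) by (simp add: assoc_mult_mat_vec[of _ M M])
  ultimately show ?case
    by simp
qed

lemma col_inv_power_bound:
  assumes w: "barrier w" and s: "s \<in> {1..<M - 1}" and r: "r < M"
  defines "D \<equiv> t * lam (s + 1) * (w s - nbr_avg w s)"
  shows "0 \<le> col (inv_mat N ^\<^sub>m Suc p) s $ r \<and> D * col (inv_mat N ^\<^sub>m Suc p) s $ r \<le> w r"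
proof -
  let ?y = "col (inv_mat N) s"
  have sM: "s < M"
    using s by auto
  have y: "?y \<in> carrier_vec M"
    using inv_N(3) by (metis carrier_matD(1) col_dim)
  have Ny: "N *\<^sub>v ?y = unit_vec M s"
    using col_mult2[OF N_carrier inv_N(3) sM] inv_N(1) sM by simp
  have "0 \<le> ?y $ q \<and> D * ?y $ q \<le> vec M w $ q" if "q < M" for q
  proof (rule comparison[OF y _ _ _ that])
    fix r assume r: "r < M"
    show "0 \<le> (N *\<^sub>v ?y) $ r"
      using r Ny sM by simp
    have "0 \<le> w r"
      using w r by (simp add: barrier_def)
    then show "D * (N *\<^sub>v ?y) $ r \<le> (N *\<^sub>v vec M w) $ r"
      using r Ny sM s N_mult_barrier[OF w r] by (cases "r = s") (auto simp: D_def)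
  qed simp
  then have "0 \<le> (inv_mat N ^\<^sub>m p *\<^sub>v ?y) $ r \<and> D * (inv_mat N ^\<^sub>m p *\<^sub>v ?y) $ r \<le> w r"
    using inv_power_mult_bound[OF w y _ r, of D] by simp
  moreover have "col (inv_mat N ^\<^sub>m Suc p) s = inv_mat N ^\<^sub>m p *\<^sub>v ?y"
    unfolding pow_mat.simps by (rule col_mult2[OF pow_carrier_mat[OF inv_N(3)] inv_N(3) sM])
  ultimately show ?thesis
    by (simp only:)
qed

end

theorem lemma7p3:
  fixes M j :: nat and t :: real and i b k :: "nat \<Rightarrow> real"
    and lam :: "nat \<Rightarrow> nat \<Rightarrow> real"
  assumes "M \<ge> 3"
    and "t > 0"
    and "strict_mono_on {1..M} i"
    and "\<And>l. l \<in> {2..M - 1} \<Longrightarrow> - (1 / (i (l + 1) - i l)) < b l \<and> b l < 1 / (i l - i (l - 1))"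
    and "\<And>l. l \<in> {2..M - 1} \<Longrightarrow> k l \<ge> 0"
    and "j \<in> {2..M - 1}"
    and "\<And>n l. l \<in> {2..M - 1} \<Longrightarrow> lam n l \<ge> 0"
    and "filterlim (\<lambda>n. lam n j) at_top sequentially"
  shows "(\<forall>n. invertible_mat (N_mat M i b t k (lam n)))
    \<and> vec_LIMSEQ (\<lambda>n. col (inv_mat (N_mat M i b t k (lam n))) (j - 1)) (0\<^sub>v M)
    \<and> (\<forall>p\<ge>1. vec_LIMSEQ (\<lambda>n. col (inv_mat (N_mat M i b t k (lam n)) ^\<^sub>m p) (j - 1)) (0\<^sub>v M))"
proof -
  interpret tridiagonal M t i b k
    by unfold_locales (use assms in auto)
  have rates: "tridiagonal_rates M t i b k (lam n)" for n
    by unfold_locales (use assms in auto)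
  let ?B = "\<lambda>n. inv_mat (N_mat M i b t k (lam n))"
  have B: "?B n \<in> carrier_mat M M" for n
    using tridiagonal_rates.inv_N(3)[OF rates] .
  have s: "j - 1 \<in> {1..<M - 1}" and j: "j - 1 + 1 = j"
    using assms(6) by auto
  obtain w where w: "barrier w"
    using barrier_exists by blast
  define \<delta> where "\<delta> = w (j - 1) - nbr_avg w (j - 1)"
  have \<delta>: "0 < \<delta>"
    using w s by (simp add: barrier_def \<delta>_def)
  have lim: "vec_LIMSEQ (\<lambda>n. col (?B n ^\<^sub>m Suc p) (j - 1)) (0\<^sub>v M)" for p
  proof -
    have "(\<lambda>n. col (?B n ^\<^sub>m Suc p) (j - 1) $ r) \<longlonglongrightarrow> 0" if r: "r < M" for r
    proof (rule tendsto_sandwich)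
      have bound: "0 \<le> col (?B n ^\<^sub>m Suc p) (j - 1) $ r"
          "t * \<delta> * lam n j * col (?B n ^\<^sub>m Suc p) (j - 1) $ r \<le> w r" for n
        using tridiagonal_rates.col_inv_power_bound[OF rates w s r, of n p]
        unfolding j \<delta>_def[symmetric] by (simp_all add: ac_simps)
      show "\<forall>\<^sub>F n in sequentially. 0 \<le> col (?B n ^\<^sub>m Suc p) (j - 1) $ r"
        using bound(1) by simp
      have "\<forall>\<^sub>F n in sequentially. 0 < lam n j"
        using assms(8) by (simp add: filterlim_at_top_dense)
      then show "\<forall>\<^sub>F n in sequentially.
          col (?B n ^\<^sub>m Suc p) (j - 1) $ r \<le> w r / (t * \<delta> * lam n j)"
      proof eventually_elim
        case (elim n)
        then have "0 < t * \<delta> * lam n j"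
          using \<delta> \<open>t > 0\<close> by simp
        then show ?case
          using bound(2)[of n] by (simp add: pos_le_divide_eq mult.commute)
      qed
      have "filterlim (\<lambda>n. t * \<delta> * lam n j) at_top sequentially"
        using \<delta> \<open>t > 0\<close> by (intro filterlim_tendsto_pos_mult_at_top[OF tendsto_const _ assms(8)]) simp
      then show "(\<lambda>n. w r / (t * \<delta> * lam n j)) \<longlonglongrightarrow> 0"
        by (intro real_tendsto_divide_at_top[OF tendsto_const])
    qed simp
    moreover have "dim_vec (col (?B n ^\<^sub>m Suc p) (j - 1)) = M" for n
      using B[of n] by simp
    ultimately show ?thesis
      unfolding vec_LIMSEQ_def by simp
  qed
  have "vec_LIMSEQ (\<lambda>n. col (?B n) (j - 1)) (0\<^sub>v M)"
    using lim[of 0] B by simp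
  moreover have "vec_LIMSEQ (\<lambda>n. col (?B n ^\<^sub>m p) (j - 1)) (0\<^sub>v M)" if "p \<ge> 1" for p
    using lim[of "p - 1"] that by simp
  moreover have "invertible_mat (N_mat M i b t k (lam n))" for n
    using tridiagonal_rates.invertible_N[OF rates] .
  ultimately show ?thesis
    by (intro conjI allI impI)
qed

end
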